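(* Suppose that $x_{i,j}\in\mathcal D$ for all $1\le i\le m$, $1\le j\le n_i$. Then there is a unique $\theta\in\Theta^m$ that is non-decreasing and satisfies, for all non-decreasing $\lambda\in\Theta^m$, $$\ell(\lambda\mid\mathbf x)\le\ell(\theta\mid\mathbf x).$$
   Context: Setting. $\{f(x\mid\theta):\theta\in\Theta\}$ is a one-parameter family of probability density functions on $\mathbb R$, with $\Theta\subset\mathbb R$. Put $\mathcal D=\{x\in\mathbb R: (\exists\theta\in\Theta)\ f(x\mid\theta)>0\}$; elements of $\mathcal D$ are called observable. Standing assumptions: (1) Either all the $f(\cdot\mid\theta)$ are PDFs (probability mass functions) of discrete real random variables, or all of them are PDFs of absolutely continuous real random variables; in particular $f\ge 0$. (2) $\mathcal D\subset\Theta$ and $\Theta$ is a real interval of positive length. (3) For every $t\ge1$ and all $y_1,\dots,y_t\in\mathcal D$, with arithmetic mean $\overline y$, the function $\theta\mapsto L(\theta\mid\mathbf y)=\prod_{s=1}^t f(y_s\mid\theta)$ is strictly increasing on $\{\theta\in\Theta:\theta\le\overline y\}$ and strictly decreasing on $\{\theta\in\Theta:\theta\ge\overline y\}$. Data. $m\ge1$ and $n_1,\dots,n_m\ge1$ are integers, and $\mathbf x=(x_{i,j})_{1\le i\le m,\,1\le j\le n_i}$ is a doubly-indexed vector of real numbers (observations of independent random variables $X_{i,j}$ with PDF $f(\cdot\mid\theta_i)$). For $\lambda=\langle\lambda_1,\dots,\lambda_m\rangle\in\Theta^m$, the compound likelihood is $\ell(\lambda\mid\mathbf x)=\prod_{i=1}^m\prod_{j=1}^{n_i}f(x_{i,j}\mid\lambda_i)$.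 A vector $\lambda\in\Theta^m$ is non-decreasing if $i\le k$ implies $\lambda_i\le\lambda_k$. *)

theory Defs
  imports "HOL-Probability.Probability"
begin

text \<open>Throughout, \<open>f x \<theta>\<close> stands for \<open>f(x | \<theta>)\<close>; only its values for \<open>\<theta>\<close> in the parameter set
  \<open>\<Theta>\<close> are relevant.\<close>

definition discrete_pdf :: "(real \<Rightarrow> real) \<Rightarrow> bool" where
  "discrete_pdf g \<longleftrightarrow> (\<exists>p :: real pmf. g = pmf p)"

definition continuous_pdf :: "(real \<Rightarrow> real) \<Rightarrow> bool" where
  "continuous_pdf g \<longleftrightarrow>
     g \<in> borel_measurable borel \<and> (\<forall>x. 0 \<le> g x) \<and> prob_space (density lborel (\<lambda>x. ennreal (g x)))"

definition observable :: "(real \<Rightarrow> real \<Rightarrow> real) \<Rightarrow> real set \<Rightarrow> real set" where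
  "observable f \<Theta> = {x. \<exists>\<theta>\<in>\<Theta>. f x \<theta> > 0}"

definition likelihood :: "(real \<Rightarrow> real \<Rightarrow> real) \<Rightarrow> nat \<Rightarrow> (nat \<Rightarrow> real) \<Rightarrow> real \<Rightarrow> real" where
  "likelihood f t y \<theta> = (\<Prod>s=1..t. f (y s) \<theta>)"

definition arith_mean :: "nat \<Rightarrow> (nat \<Rightarrow> real) \<Rightarrow> real" where
  "arith_mean t y = (\<Sum>s=1..t. y s) / real t"

locale mean_unimodal_family =
  fixes f :: "real \<Rightarrow> real \<Rightarrow> real" and \<Theta> :: "real set"
  assumes pdfs: "(\<forall>\<theta>\<in>\<Theta>. discrete_pdf (\<lambda>x. f x \<theta>)) \<or> (\<forall>\<theta>\<in>\<Theta>. continuous_pdf (\<lambda>x. f x \<theta>))"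
    and observable_subset: "observable f \<Theta> \<subseteq> \<Theta>"
    and interval: "is_interval \<Theta>"
    and positive_length: "\<exists>a\<in>\<Theta>. \<exists>b\<in>\<Theta>. a < b"
    and likelihood_increasing:
      "\<And>t y. t \<ge> 1 \<Longrightarrow> (\<forall>s\<in>{1..t}. y s \<in> observable f \<Theta>) \<Longrightarrow>
         strict_mono_on {\<theta>\<in>\<Theta>. \<theta> \<le> arith_mean t y} (likelihood f t y)"
    and likelihood_decreasing:
      "\<And>t y. t \<ge> 1 \<Longrightarrow> (\<forall>s\<in>{1..t}. y s \<in> observable f \<Theta>) \<Longrightarrow>
         strict_antimono_on {\<theta>\<in>\<Theta>. \<theta> \<ge> arith_mean t y} (likelihood f t y)"

definition compound_likelihood ::
  "(real \<Rightarrow> real \<Rightarrow> real) \<Rightarrow> nat \<Rightarrow> (nat \<Rightarrow> nat) \<Rightarrow> (nat \<Rightarrow> nat \<Rightarrow> real) \<Rightarrow> (nat \<Rightarrow> real) \<Rightarrow> real" where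
  "compound_likelihood f m n x \<theta> = (\<Prod>i=1..m. \<Prod>j=1..n i. f (x i j) (\<theta> i))"

text \<open>Vectors in \<open>\<Theta>\<^sup>m\<close> are extensional functions on \<open>{1..m}\<close> (constantly \<open>undefined\<close> outside), so that
  equality of such functions is equality of vectors.\<close>

definition nondecreasing_vectors :: "nat \<Rightarrow> real set \<Rightarrow> (nat \<Rightarrow> real) set" where
  "nondecreasing_vectors m \<Theta> = {\<theta> \<in> {1..m} \<rightarrow>\<^sub>E \<Theta>. mono_on {1..m} \<theta>}"

end

theory Submission imports Defs begin

text \<open>
  The argument is the correctness proof of the pool-adjacent-violators algorithm. A block of
  observations has a likelihood that is strictly unimodal about the block mean. If the block means
  are non-decreasing, the vector of means is the only maximizer. Otherwise two adjacent blocks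
  have decreasing means, and whenever a vector takes values \<open>a < b\<close> on them, some common value in
  \<open>[a, b]\<close> does strictly better, unless the likelihood vanishes; so the two blocks may be merged,
  and induction on the number of blocks applies. A constant vector equal to the overall mean has
  positive likelihood, so vanishing likelihoods do not spoil uniqueness.
\<close>

section \<open>Means of lists and splittings of unsorted lists\<close>

definition list_mean :: "real list \<Rightarrow> real" where
  "list_mean B = sum_list B / real (length B)"

lemma list_mean_bounds:
  assumes "B \<noteq> []" "\<And>y. y \<in> set B \<Longrightarrow> a \<le> y" "\<And>y. y \<in> set B \<Longrightarrow> y \<le> b"
  shows "a \<le> list_mean B" "list_mean B \<le> b"
proof -
  have "(\<Sum>y\<leftarrow>B. a) \<le> (\<Sum>y\<leftarrow>B. y)" "(\<Sum>y\<leftarrow>B. y) \<le> (\<Sum>y\<leftarrow>B. b)"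
    using assms(2,3) by (blast intro: sum_list_mono)+
  then show "a \<le> list_mean B" "list_mean B \<le> b"
    using assms(1) by (auto simp: list_mean_def sum_list_triv field_simps)
qed

lemma sorted_append_Cons_Cons_dup:
  "sorted (us @ c # c # vs) \<longleftrightarrow> sorted (us @ c # vs)" for c :: "'a::linorder"
  by (auto simp: sorted_append)

text \<open>Keeps a vector feasible when two neighbouring values are pooled into one between them:
  \<open>c\<close> is above everything before \<open>a\<close> and below everything after
  \<open>b\<close>.\<close>

lemma sorted_append_replace:
  fixes a b c :: "'a::linorder"
  assumes "sorted (us @ a # b # vs)" "a \<le> c" "c \<le> b"
  shows "sorted (us @ c # vs)"
  using assms by (fastforce simp: sorted_append)

text \<open>Sortedness can be tested on consecutive entries, so a failure shows up at some
  neighbours. With \<open>h = list_mean\<close> these are the two blocks to be pooled.\<close>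

lemma not_sorted_adjacent:
  fixes h :: "'a \<Rightarrow> 'b::linorder"
  assumes "\<not> sorted (map h zs)"
  obtains xs A B ys where "zs = xs @ A # B # ys" "h B < h A"
proof -
  obtain i where i: "Suc i < length zs" "h (zs ! Suc i) < h (zs ! i)"
    using assms by (auto simp: sorted_iff_nth_Suc not_le)
  have "zs = take i zs @ zs ! i # zs ! Suc i # drop (Suc (Suc i)) zs"
    using i by (metis Cons_nth_drop_Suc Suc_lessD append_take_drop_id)
  with i that show thesis by blast
qed

section \<open>Unimodal likelihood of one block, and pooling of two blocks\<close>

context mean_unimodal_family
begin

text \<open>Blocks are lists, so that pooling is \<open>A @ B\<close> and the likelihoods of the two
  blocks multiply.\<close>

definition block_likelihood :: "real list \<Rightarrow> real \<Rightarrow> real" where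
  "block_likelihood B \<theta> = (\<Prod>y\<leftarrow>B. f y \<theta>)"

definition observable_block :: "real list \<Rightarrow> bool" where
  "observable_block B \<longleftrightarrow> B \<noteq> [] \<and> set B \<subseteq> observable f \<Theta>"

lemma block_likelihood_append:
  "block_likelihood (A @ B) \<theta> = block_likelihood A \<theta> * block_likelihood B \<theta>"
  by (simp add: block_likelihood_def)

lemma pdf_nonneg: "\<theta> \<in> \<Theta> \<Longrightarrow> 0 \<le> f y \<theta>"
  using pdfs unfolding discrete_pdf_def continuous_pdf_def by (metis pmf_nonneg)

lemma block_likelihood_nonneg: "\<theta> \<in> \<Theta> \<Longrightarrow> 0 \<le> block_likelihood B \<theta>"
  unfolding block_likelihood_def by (induction B) (auto simp: pdf_nonneg)

text \<open>The assumptions on the family number a sample from 1, lists are indexed from 0; the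
  shift \<open>s - 1\<close> lets those assumptions speak of blocks.\<close>

lemma likelihood_nth: "likelihood f (length B) (\<lambda>s. B ! (s - 1)) = block_likelihood B"
proof
  fix \<theta>
  have "(\<Prod>s=1..length B. f (B ! (s - 1)) \<theta>) = (\<Prod>i=0..<length B. f (B ! i) \<theta>)"
    by (rule prod.reindex_bij_witness[of _ Suc "\<lambda>s. s - 1"]) auto
  then show "likelihood f (length B) (\<lambda>s. B ! (s - 1)) \<theta> = block_likelihood B \<theta>"
    by (simp add: likelihood_def block_likelihood_def prod.list_conv_set_nth)
qed

lemma arith_mean_nth: "arith_mean (length B) (\<lambda>s. B ! (s - 1)) = list_mean B"
proof -
  have "(\<Sum>s=1..length B. B ! (s - 1)) = (\<Sum>i=0..<length B. B ! i)"
    by (rule sum.reindex_bij_witness[of _ Suc "\<lambda>s. s - 1"]) auto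
  then show ?thesis
    by (simp add: arith_mean_def list_mean_def sum_list_sum_nth)
qed

lemma
  assumes "observable_block B"
  shows block_increasing: "strict_mono_on {\<theta>\<in>\<Theta>. \<theta> \<le> list_mean B} (block_likelihood B)"
    and block_decreasing: "strict_antimono_on {\<theta>\<in>\<Theta>. \<theta> \<ge> list_mean B} (block_likelihood B)"
proof -
  have "1 \<le> length B" "\<forall>s\<in>{1..length B}. B ! (s - 1) \<in> observable f \<Theta>"
    using assms by (auto simp: observable_block_def Suc_le_eq subset_iff)
  from likelihood_increasing[OF this] likelihood_decreasing[OF this]
  show "strict_mono_on {\<theta>\<in>\<Theta>. \<theta> \<le> list_mean B} (block_likelihood B)"
    "strict_antimono_on {\<theta>\<in>\<Theta>. \<theta> \<ge> list_mean B} (block_likelihood B)"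
    by (simp_all only: likelihood_nth arith_mean_nth)
qed

lemma block_less_left:
  assumes "observable_block B" "a \<in> \<Theta>" "b \<in> \<Theta>" "a < b" "b \<le> list_mean B"
  shows "block_likelihood B a < block_likelihood B b"
  using block_increasing[OF assms(1)] assms by (auto simp: monotone_on_def)

lemma block_less_right:
  assumes "observable_block B" "a \<in> \<Theta>" "b \<in> \<Theta>" "a < b" "list_mean B \<le> a"
  shows "block_likelihood B b < block_likelihood B a"
  using block_decreasing[OF assms(1)] assms by (auto simp: monotone_on_def)

lemma between_mem: "a \<in> \<Theta> \<Longrightarrow> b \<in> \<Theta> \<Longrightarrow> a \<le> c \<Longrightarrow> c \<le> b \<Longrightarrow> c \<in> \<Theta>"
  using interval mem_is_interval_1_I by blast

text \<open>The mean lies between the least and the greatest observation. Both are observable, hence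
  in \<Theta>, and \<Theta> is an interval.\<close>

lemma list_mean_mem:
  assumes "observable_block B"
  shows "list_mean B \<in> \<Theta>"
proof (rule between_mem)
  have B: "B \<noteq> []" "set B \<subseteq> \<Theta>"
    using assms observable_subset by (auto simp: observable_block_def)
  then show "Min (set B) \<in> \<Theta>" "Max (set B) \<in> \<Theta>"
    using Min_in[of "set B"] Max_in[of "set B"] by auto
  show "Min (set B) \<le> list_mean B" "list_mean B \<le> Max (set B)"
    using B(1) list_mean_bounds[of B "Min (set B)" "Max (set B)"] by auto
qed

lemma block_less_mean:
  assumes "observable_block B" "a \<in> \<Theta>" "a \<noteq> list_mean B"
  shows "block_likelihood B a < block_likelihood B (list_mean B)"
  using assms block_less_left[of B a "list_mean B"] block_less_right[of B "list_mean B" a]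
    list_mean_mem[of B] by (cases "a < list_mean B") auto

lemma block_le_mean:
  assumes "observable_block B" "a \<in> \<Theta>"
  shows "block_likelihood B a \<le> block_likelihood B (list_mean B)"
  using block_less_mean[OF assms] by (cases "a = list_mean B") auto

text \<open>Since \<Theta> has positive length, it contains a point other than the mean; the
  likelihood there is nonnegative and strictly below the one at the mean.\<close>

lemma block_mean_pos:
  assumes "observable_block B"
  shows "0 < block_likelihood B (list_mean B)"
proof -
  obtain a where "a \<in> \<Theta>" "a \<noteq> list_mean B"
    using positive_length by (metis less_irrefl)
  with block_less_mean[OF assms this] block_likelihood_nonneg[of a B] show ?thesis
    by linarith
qed

text \<open>Take for \<open>c\<close> the point of \<open>[a, b]\<close> nearest to
  \<open>list_mean A\<close>. Going from \<open>a\<close> to \<open>c\<close> approaches the mean of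
  \<open>A\<close>. If \<open>c < b\<close>, then \<open>c\<close> is at least
  \<open>list_mean A\<close>, hence above \<open>list_mean B\<close>, so going from \<open>b\<close>
  down to \<open>c\<close> approaches the mean of \<open>B\<close>. Neither factor
  decreases.\<close>

lemma pool_pair:
  assumes "observable_block A" "observable_block B" "list_mean B < list_mean A"
    and "a \<in> \<Theta>" "b \<in> \<Theta>" "a \<le> b"
  obtains c where "a \<le> c" "c \<le> b" "c \<in> \<Theta>"
    "block_likelihood A a * block_likelihood B b \<le> block_likelihood (A @ B) c"
    "a < b \<Longrightarrow> 0 < block_likelihood A a * block_likelihood B b \<Longrightarrow>
      block_likelihood A a * block_likelihood B b < block_likelihood (A @ B) c"
proof -
  define c where "c = (if a < list_mean A then min (list_mean A) b else a)"
  have c: "a \<le> c" "c \<le> b" "c \<in> \<Theta>"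
    using assms list_mean_mem[of A] by (auto simp: c_def min_def)
  have le_A: "block_likelihood A a \<le> block_likelihood A c"
    using block_less_left[of A a c] c assms by (auto simp: c_def le_less min_def split: if_splits)
  have le_B: "block_likelihood B b \<le> block_likelihood B c"
    using block_less_right[of B c b] c assms
    by (cases "c = b") (auto simp: c_def min_def split: if_splits)
  \<comment> \<open>If \<open>a < list_mean A\<close>, then \<open>c\<close> exceeds
    \<open>a\<close> and the factor of \<open>A\<close> grows strictly; otherwise
    \<open>c = a < b\<close> and the factor of \<open>B\<close> does.\<close>
  have less: "block_likelihood A a < block_likelihood A c \<or>
      block_likelihood B b < block_likelihood B c" if "a < b"
  proof (cases "a < list_mean A")
    case True
    then show ?thesis
      using block_less_left[of A a c] c assms that by (auto simp: c_def min_def)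
  next
    case False
    then show ?thesis
      using block_less_right[of B c b] c assms that by (auto simp: c_def)
  qed
  note nonneg = block_likelihood_nonneg[OF \<open>a \<in> \<Theta>\<close>] block_likelihood_nonneg[OF \<open>b \<in> \<Theta>\<close>]
    block_likelihood_nonneg[OF \<open>c \<in> \<Theta>\<close>]
  show thesis
  proof (rule that[OF c])
    show "block_likelihood A a * block_likelihood B b \<le> block_likelihood (A @ B) c"
      using le_A le_B nonneg by (auto simp: block_likelihood_append intro!: mult_mono)
  next
    assume "a < b" and pos: "0 < block_likelihood A a * block_likelihood B b"
    \<comment> \<open>A strict gain in one factor survives in the product only if the other factor
      does not vanish.\<close>
    then have pos: "0 < block_likelihood A a" "0 < block_likelihood B b"
      using nonneg by (auto simp: zero_less_mult_iff dest: leD)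
    from less[OF \<open>a < b\<close>]
    show "block_likelihood A a * block_likelihood B b < block_likelihood (A @ B) c"
    proof
      assume "block_likelihood A a < block_likelihood A c"
      then show ?thesis using le_B pos
        unfolding block_likelihood_append by (intro mult_less_le_imp_less) auto
    next
      assume "block_likelihood B b < block_likelihood B c"
      then show ?thesis using le_A pos
        unfolding block_likelihood_append by (intro mult_le_less_imp_less) auto
    qed
  qed
qed

section \<open>Order-restricted maximizers for a sequence of blocks\<close>

definition blocks_likelihood :: "real list list \<Rightarrow> real list \<Rightarrow> real" where
  "blocks_likelihood Bs ls = (\<Prod>(B, l)\<leftarrow>zip Bs ls. block_likelihood B l)"

definition isotonic_lists :: "nat \<Rightarrow> real list set" where
  "isotonic_lists k = {ls. length ls = k \<and> set ls \<subseteq> \<Theta> \<and> sorted ls}"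

text \<open>The maximization problem of the theorem with lists for vectors: the number of blocks can
  then vary in an induction, and a list can be split at two adjacent blocks.\<close>

definition isotonic_mle :: "real list list \<Rightarrow> real list \<Rightarrow> bool" where
  "isotonic_mle Bs ls \<longleftrightarrow> ls \<in> isotonic_lists (length Bs) \<and>
     (\<forall>ls'\<in>isotonic_lists (length Bs). blocks_likelihood Bs ls' \<le> blocks_likelihood Bs ls)"

lemma blocks_likelihood_Nil [simp]: "blocks_likelihood [] ls = 1"
  by (simp add: blocks_likelihood_def)

lemma blocks_likelihood_Cons [simp]:
  "blocks_likelihood (B # Bs) (l # ls) = block_likelihood B l * blocks_likelihood Bs ls"
  by (simp add: blocks_likelihood_def)

lemma blocks_likelihood_append:
  "length xs = length us \<Longrightarrow>
    blocks_likelihood (xs @ ys) (us @ vs) = blocks_likelihood xs us * blocks_likelihood ys vs"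
  by (simp add: blocks_likelihood_def)

lemma blocks_likelihood_nonneg:
  "set ls \<subseteq> \<Theta> \<Longrightarrow> length Bs = length ls \<Longrightarrow> 0 \<le> blocks_likelihood Bs ls"
  by (induction Bs ls rule: list_induct2') (auto simp: block_likelihood_nonneg)

lemma blocks_likelihood_replicate:
  "blocks_likelihood Bs (replicate (length Bs) c) = block_likelihood (concat Bs) c"
  by (induction Bs) (auto simp: block_likelihood_append, simp add: block_likelihood_def)

text \<open>A constant vector is admissible whatever the order of the block means, and its
  likelihood is that of all observations taken as one block, which is positive at their overall
  mean.\<close>

lemma isotonic_mle_pos:
  assumes "\<forall>B\<in>set Bs. observable_block B" "isotonic_mle Bs ls"
  shows "0 < blocks_likelihood Bs ls"
proof (cases "Bs = []")
  case False
  then have B: "observable_block (concat Bs)"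
    using assms(1) by (cases Bs) (auto simp: observable_block_def)
  let ?l = "replicate (length Bs) (list_mean (concat Bs))"
  have "?l \<in> isotonic_lists (length Bs)"
    using list_mean_mem[OF B] by (auto simp: isotonic_lists_def)
  then have "blocks_likelihood Bs ?l \<le> blocks_likelihood Bs ls"
    using assms(2) by (auto simp: isotonic_mle_def)
  with block_mean_pos[OF B] show ?thesis
    by (simp add: blocks_likelihood_replicate)
qed simp

section \<open>The case of non-decreasing block means\<close>

lemma blocks_mean_pos:
  "\<forall>B\<in>set Bs. observable_block B \<Longrightarrow> 0 < blocks_likelihood Bs (map list_mean Bs)"
  by (induction Bs) (auto simp: block_mean_pos)

lemma blocks_le_means:
  assumes "length Bs = length ls" "\<forall>B\<in>set Bs. observable_block B" "set ls \<subseteq> \<Theta>"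
  shows "blocks_likelihood Bs ls \<le> blocks_likelihood Bs (map list_mean Bs)"
  using assms
  by (induction Bs ls rule: list_induct2)
    (auto intro!: mult_mono block_le_mean block_likelihood_nonneg blocks_likelihood_nonneg list_mean_mem)

text \<open>Each factor is largest at its own block mean, and only there. All factors are positive
  at the means, so one strict loss makes the whole product smaller.\<close>

lemma blocks_less_means:
  assumes "length Bs = length ls" "\<forall>B\<in>set Bs. observable_block B" "set ls \<subseteq> \<Theta>"
    and "ls \<noteq> map list_mean Bs"
  shows "blocks_likelihood Bs ls < blocks_likelihood Bs (map list_mean Bs)"
  using assms
proof (induction Bs ls rule: list_induct2)
  case (Cons B Bs l ls)
  have nonneg: "0 \<le> block_likelihood B l" "0 \<le> blocks_likelihood Bs ls"
    using Cons by (auto intro: block_likelihood_nonneg blocks_likelihood_nonneg)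
  have B: "block_likelihood B l \<le> block_likelihood B (list_mean B)"
    "0 < block_likelihood B (list_mean B)"
    using Cons.prems by (auto intro: block_le_mean block_mean_pos)
  have Bs: "blocks_likelihood Bs ls \<le> blocks_likelihood Bs (map list_mean Bs)"
    "0 < blocks_likelihood Bs (map list_mean Bs)"
    using Cons by (auto intro: blocks_le_means blocks_mean_pos)
  have "block_likelihood B l * blocks_likelihood Bs ls
      < block_likelihood B (list_mean B) * blocks_likelihood Bs (map list_mean Bs)"
  proof (cases "l = list_mean B")
    case True
    with Cons have "blocks_likelihood Bs ls < blocks_likelihood Bs (map list_mean Bs)"
      by auto
    with True B show ?thesis by simp
  next
    case False
    then have "block_likelihood B l < block_likelihood B (list_mean B)"
      using Cons.prems by (auto intro: block_less_mean)
    \<comment> \<open>The intermediate product moves only the tail to its means: passing to it loses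
      nothing, and moving the head afterwards gains strictly.\<close>
    then have "block_likelihood B l * blocks_likelihood Bs (map list_mean Bs)
        < block_likelihood B (list_mean B) * blocks_likelihood Bs (map list_mean Bs)"
      using Bs by simp
    with mult_left_mono[OF Bs(1) nonneg(1)] show ?thesis by linarith
  qed
  then show ?case by simp
qed simp

text \<open>The vector of means is the only maximizer even without the order constraint; here it
  also satisfies that constraint.\<close>

lemma isotonic_mle_sorted_means:
  assumes "\<forall>B\<in>set Bs. observable_block B" "sorted (map list_mean Bs)"
  shows "\<exists>!ls. isotonic_mle Bs ls"
proof (rule ex1I)
  have mem: "map list_mean Bs \<in> isotonic_lists (length Bs)"
    using assms list_mean_mem by (auto simp: isotonic_lists_def)
  then show "isotonic_mle Bs (map list_mean Bs)"
    using assms blocks_le_means by (auto simp: isotonic_mle_def isotonic_lists_def)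
  show "ls = map list_mean Bs" if "isotonic_mle Bs ls" for ls
  proof (rule ccontr)
    assume "ls \<noteq> map list_mean Bs"
    then have "blocks_likelihood Bs ls < blocks_likelihood Bs (map list_mean Bs)"
      using that assms by (intro blocks_less_means) (auto simp: isotonic_mle_def isotonic_lists_def)
    then show False
      using that mem by (fastforce simp: isotonic_mle_def)
  qed
qed

section \<open>Merging two adjacent blocks with decreasing means\<close>

lemma blocks_likelihood_merge:
  assumes "length xs = length us"
  shows "blocks_likelihood (xs @ A # B # ys) (us @ c # c # vs) =
    blocks_likelihood (xs @ (A @ B) # ys) (us @ c # vs)"
  using assms by (simp add: blocks_likelihood_append block_likelihood_append)

lemma length_append_Cons_ConsE:
  assumes "length ls = length (xs @ A # B # ys)"
  obtains us a b vs where "ls = us @ a # b # vs" "length us = length xs" "length vs = length ys"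
proof -
  have "length (drop (length xs) ls) = Suc (Suc (length ys))"
    using assms by simp
  then obtain a b vs where "drop (length xs) ls = a # b # vs" "length vs = length ys"
    by (metis length_Suc_conv)
  with that[of "take (length xs) ls" a b vs] assms append_take_drop_id[of "length xs" ls]
  show thesis by simp
qed

text \<open>This is \<open>pool_pair\<close> inside a longer vector: the other blocks contribute the
  same factor \<open>k\<close> to both sides. A positive total likelihood forces \<open>k\<close> to
  be positive, which preserves strictness.\<close>

lemma pool_step:
  assumes "observable_block A" "observable_block B" "list_mean B < list_mean A"
    and ls: "us @ a # b # vs \<in> isotonic_lists (length (xs @ A # B # ys))"
    and len: "length us = length xs" "length vs = length ys"
  obtains c where "us @ c # vs \<in> isotonic_lists (length (xs @ (A @ B) # ys))"
    "blocks_likelihood (xs @ A # B # ys) (us @ a # b # vs)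
      \<le> blocks_likelihood (xs @ (A @ B) # ys) (us @ c # vs)"
    "a < b \<Longrightarrow> 0 < blocks_likelihood (xs @ A # B # ys) (us @ a # b # vs) \<Longrightarrow>
      blocks_likelihood (xs @ A # B # ys) (us @ a # b # vs)
        < blocks_likelihood (xs @ (A @ B) # ys) (us @ c # vs)"
proof -
  have mem: "a \<in> \<Theta>" "b \<in> \<Theta>" "a \<le> b" "set us \<subseteq> \<Theta>" "set vs \<subseteq> \<Theta>"
    using ls by (auto simp: isotonic_lists_def sorted_append)
  obtain c where c: "a \<le> c" "c \<le> b" "c \<in> \<Theta>"
    "block_likelihood A a * block_likelihood B b \<le> block_likelihood (A @ B) c"
    "a < b \<Longrightarrow> 0 < block_likelihood A a * block_likelihood B b \<Longrightarrow>
      block_likelihood A a * block_likelihood B b < block_likelihood (A @ B) c"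
    using pool_pair[OF assms(1-3) mem(1-3)] by metis
  define k where "k = blocks_likelihood xs us * blocks_likelihood ys vs"
  have k: "0 \<le> k"
    using mem len by (auto simp: k_def intro!: mult_nonneg_nonneg blocks_likelihood_nonneg)
  have split: "blocks_likelihood (xs @ A # B # ys) (us @ a # b # vs)
      = k * (block_likelihood A a * block_likelihood B b)"
    "blocks_likelihood (xs @ (A @ B) # ys) (us @ c # vs) = k * block_likelihood (A @ B) c"
    using len by (simp_all add: blocks_likelihood_append k_def)
  show thesis
  proof (rule that[of c], unfold split)
    show "us @ c # vs \<in> isotonic_lists (length (xs @ (A @ B) # ys))"
      using ls len c sorted_append_replace[of us a b vs c] by (auto simp: isotonic_lists_def)
    show "k * (block_likelihood A a * block_likelihood B b) \<le> k * block_likelihood (A @ B) c"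
      using c(4) k by (rule mult_left_mono)
    assume "a < b" "0 < k * (block_likelihood A a * block_likelihood B b)"
    then show "k * (block_likelihood A a * block_likelihood B b) < k * block_likelihood (A @ B) c"
      using c(5) k by (simp add: zero_less_mult_iff)
  qed
qed

text \<open>Vectors for the merged problem correspond to vectors for the original one with equal
  values on \<open>A\<close> and \<open>B\<close>, with the same likelihood. Pooling shows that the
  original problem has no larger maximum and that its maximizers take equal values on
  \<open>A\<close> and \<open>B\<close>.\<close>

lemma isotonic_mle_merge:
  assumes obs: "\<forall>B\<in>set (xs @ A # B # ys). observable_block B"
    and less: "list_mean B < list_mean A"
    and ex1: "\<exists>!ls. isotonic_mle (xs @ (A @ B) # ys) ls"
  shows "\<exists>!ls. isotonic_mle (xs @ A # B # ys) ls"
proof -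
  let ?Bs = "xs @ A # B # ys" and ?Cs = "xs @ (A @ B) # ys"
  have AB: "observable_block A" "observable_block B"
    using obs by auto
  obtain ms where ms: "isotonic_mle ?Cs ms" and uniq: "\<And>ls. isotonic_mle ?Cs ls \<Longrightarrow> ls = ms"
    using ex1 by blast
  have mem_dup: "us @ c # c # vs \<in> isotonic_lists (length ?Bs) \<longleftrightarrow>
      us @ c # vs \<in> isotonic_lists (length ?Cs)" for us c vs
    by (simp add: isotonic_lists_def sorted_append_Cons_Cons_dup)
  have "length ms = Suc (length xs + length ys)"
    using ms by (simp add: isotonic_mle_def isotonic_lists_def)
  then have ms_split: "ms = take (length xs) ms @ ms ! length xs # drop (Suc (length xs)) ms"
    by (simp add: id_take_nth_drop)
  define us c vs where "us = take (length xs) ms" and "c = ms ! length xs"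
    and "vs = drop (Suc (length xs)) ms"
  have ms_eq: "ms = us @ c # vs" and us: "length us = length xs"
    using ms_split \<open>length ms = _\<close> by (simp_all add: us_def c_def vs_def)
  \<comment> \<open>Any competitor is dominated by its pooled version, which competes in the merged
    problem won by \<open>ms\<close>.\<close>
  have bound: "blocks_likelihood ?Bs ls \<le> blocks_likelihood ?Cs ms"
    if ls: "ls \<in> isotonic_lists (length ?Bs)" for ls
  proof -
    obtain us' a b vs' where ls_eq: "ls = us' @ a # b # vs'"
      and len: "length us' = length xs" "length vs' = length ys"
      using ls unfolding isotonic_lists_def by (blast elim: length_append_Cons_ConsE)
    obtain d where "us' @ d # vs' \<in> isotonic_lists (length ?Cs)"
      "blocks_likelihood ?Bs ls \<le> blocks_likelihood ?Cs (us' @ d # vs')"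
      using pool_step[OF AB less ls[unfolded ls_eq] len] unfolding ls_eq by metis
    with ms show ?thesis by (fastforce simp: isotonic_mle_def)
  qed
  have dup: "blocks_likelihood ?Bs (us @ c # c # vs) = blocks_likelihood ?Cs ms"
    using us by (simp only: ms_eq blocks_likelihood_merge)
  have memd: "us @ c # c # vs \<in> isotonic_lists (length ?Bs)"
    using ms unfolding mem_dup ms_eq isotonic_mle_def by blast
  show ?thesis
  proof (rule ex1I)
    show "isotonic_mle ?Bs (us @ c # c # vs)"
      unfolding isotonic_mle_def dup using memd bound by blast
  next
    fix ls assume mle: "isotonic_mle ?Bs ls"
    then have ls: "ls \<in> isotonic_lists (length ?Bs)"
      by (simp add: isotonic_mle_def)
    obtain us' a b vs' where ls_eq: "ls = us' @ a # b # vs'"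
      and len: "length us' = length xs" "length vs' = length ys"
      using ls unfolding isotonic_lists_def by (blast elim: length_append_Cons_ConsE)
    have eq: "blocks_likelihood ?Bs ls = blocks_likelihood ?Cs ms"
      using mle memd bound[OF ls] dup unfolding isotonic_mle_def by fastforce
    obtain d where d: "us' @ d # vs' \<in> isotonic_lists (length ?Cs)"
      "a < b \<Longrightarrow> 0 < blocks_likelihood ?Bs ls \<Longrightarrow>
        blocks_likelihood ?Bs ls < blocks_likelihood ?Cs (us' @ d # vs')"
      using pool_step[OF AB less ls[unfolded ls_eq] len] unfolding ls_eq by metis
    \<comment> \<open>Distinct values would be strictly improved by pooling, since a maximizer has
      positive likelihood; the pooled vector would then beat \<open>ms\<close>.\<close>
    have "\<not> a < b"
    proof
      assume "a < b"
      from d(2)[OF this isotonic_mle_pos[OF obs mle]]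
      have "blocks_likelihood ?Cs ms < blocks_likelihood ?Cs (us' @ d # vs')"
        by (simp only: eq)
      with ms d(1) show False by (fastforce simp: isotonic_mle_def)
    qed
    moreover have "a \<le> b"
      using ls by (auto simp: ls_eq isotonic_lists_def sorted_append)
    ultimately have "a = b" by simp
    then have ls_dup: "ls = us' @ a # a # vs'"
      using ls_eq by simp
    have "us' @ a # vs' \<in> isotonic_lists (length ?Cs)"
      using ls unfolding ls_dup mem_dup .
    moreover have "blocks_likelihood ?Cs (us' @ a # vs') = blocks_likelihood ?Cs ms"
      using eq len unfolding ls_dup by (simp only: blocks_likelihood_merge)
    ultimately have "isotonic_mle ?Cs (us' @ a # vs')"
      using ms unfolding isotonic_mle_def by simp
    then have "us' @ a # vs' = us @ c # vs"
      using uniq ms_eq by blast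
    then show "ls = us @ c # c # vs"
      using len us by (simp add: ls_dup)
  qed
qed

theorem isotonic_mle_unique:
  "\<forall>B\<in>set Bs. observable_block B \<Longrightarrow> \<exists>!ls. isotonic_mle Bs ls"
proof (induction "length Bs" arbitrary: Bs rule: less_induct)
  case less
  show ?case
  proof (cases "sorted (map list_mean Bs)")
    case True
    with less.prems show ?thesis by (rule isotonic_mle_sorted_means)
  next
    case False
    then obtain xs A B ys where Bs: "Bs = xs @ A # B # ys" "list_mean B < list_mean A"
      by (rule not_sorted_adjacent)
    \<comment> \<open>The merged sequence has one block fewer, and its blocks are still
      observable.\<close>
    have "\<exists>!ls. isotonic_mle (xs @ (A @ B) # ys) ls"
      using less.prems by (intro less.hyps) (auto simp: Bs observable_block_def)
    then show ?thesis
      using less.prems Bs isotonic_mle_merge by blast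
  qed
qed

end

section \<open>Transfer from lists to vectors indexed by \<open>{1..m}\<close>\<close>

lemma map_mem_isotonic_lists:
  assumes "mean_unimodal_family f \<Theta>" "\<theta> \<in> nondecreasing_vectors m \<Theta>"
  shows "map \<theta> [1..<Suc m] \<in> mean_unimodal_family.isotonic_lists \<Theta> m"
  using assms
  by (auto simp: mean_unimodal_family.isotonic_lists_def nondecreasing_vectors_def
      sorted_iff_nth_mono mono_on_def PiE_iff simp del: upt_Suc)

theorem corollary1:
  fixes f :: "real \<Rightarrow> real \<Rightarrow> real" and \<Theta> :: "real set"
    and m :: nat and n :: "nat \<Rightarrow> nat" and x :: "nat \<Rightarrow> nat \<Rightarrow> real"
  assumes "mean_unimodal_family f \<Theta>"
    and "m \<ge> 1"
    and "\<And>i. i \<in> {1..m} \<Longrightarrow> n i \<ge> 1"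
    and "\<And>i j. i \<in> {1..m} \<Longrightarrow> j \<in> {1..n i} \<Longrightarrow> x i j \<in> observable f \<Theta>"
  shows "\<exists>!\<theta>. \<theta> \<in> nondecreasing_vectors m \<Theta> \<and>
           (\<forall>\<theta>'\<in>nondecreasing_vectors m \<Theta>.
              compound_likelihood f m n x \<theta>' \<le> compound_likelihood f m n x \<theta>)"
proof -
  interpret mean_unimodal_family f \<Theta> by fact
  \<comment> \<open>Initially there is one block for each index \<open>i\<close>, consisting of all
    observations governed by the \<open>i\<close>-th parameter.\<close>
  define Bs where "Bs = map (\<lambda>i. map (x i) [1..<Suc (n i)]) [1..<Suc m]"
  have len: "length Bs = m"
    by (simp add: Bs_def)
  \<comment> \<open>Inverse of \<open>map \<theta> [1..<Suc m]\<close>. The shift matches list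
    positions to indices from 1, and \<open>restrict\<close> makes the result extensional, so that
    uniqueness of lists yields equality of functions.\<close>
  define vec where "vec ls = restrict (\<lambda>i. ls ! (i - 1)) {1..m}" for ls :: "real list"
  have obs: "\<forall>B\<in>set Bs. observable_block B"
    using assms(3,4) by (fastforce simp: Bs_def observable_block_def simp del: upt_Suc)
  have lik: "compound_likelihood f m n x \<theta> = blocks_likelihood Bs (map \<theta> [1..<Suc m])" for \<theta>
    by (simp add: compound_likelihood_def blocks_likelihood_def block_likelihood_def Bs_def
        zip_map_map zip_same_conv_map o_def prod.distinct_set_conv_list[symmetric]
        atLeastLessThanSuc_atLeastAtMost del: upt_Suc)
  have map_mem: "map \<theta> [1..<Suc m] \<in> isotonic_lists m" if "\<theta> \<in> nondecreasing_vectors m \<Theta>" for \<theta>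
    using map_mem_isotonic_lists[OF assms(1) that] .
  have vec_mem: "vec ls \<in> nondecreasing_vectors m \<Theta>" if "ls \<in> isotonic_lists m" for ls
    using that
    by (auto simp: isotonic_lists_def nondecreasing_vectors_def vec_def mono_on_def
        sorted_iff_nth_mono subset_iff)
  have map_vec: "map (vec ls) [1..<Suc m] = ls" if "ls \<in> isotonic_lists m" for ls
    using that by (auto simp: isotonic_lists_def vec_def intro!: nth_equalityI simp del: upt_Suc)
  have vec_map: "vec (map \<theta> [1..<Suc m]) = \<theta>" if "\<theta> \<in> nondecreasing_vectors m \<Theta>" for \<theta>
    using that
    by (auto simp: nondecreasing_vectors_def vec_def PiE_iff extensional_def fun_eq_iff
        simp del: upt_Suc)
  \<comment> \<open>Every sorted list over \<Theta> of length \<open>m\<close> comes from a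
    non-decreasing vector with the same likelihood, so both problems have the same
    competitors.\<close>
  have iff: "(\<theta> \<in> nondecreasing_vectors m \<Theta> \<and> (\<forall>\<theta>'\<in>nondecreasing_vectors m \<Theta>.
      compound_likelihood f m n x \<theta>' \<le> compound_likelihood f m n x \<theta>)) \<longleftrightarrow>
    \<theta> \<in> nondecreasing_vectors m \<Theta> \<and> isotonic_mle Bs (map \<theta> [1..<Suc m])" for \<theta>
    unfolding isotonic_mle_def lik len using map_mem vec_mem map_vec by metis
  obtain ls where ls: "isotonic_mle Bs ls" "\<And>ls'. isotonic_mle Bs ls' \<Longrightarrow> ls' = ls"
    using isotonic_mle_unique[OF obs] by blast
  have "ls \<in> isotonic_lists m"
    using ls(1) by (simp add: isotonic_mle_def len)
  then show ?thesis
    unfolding iff using ls vec_mem map_vec vec_map by (intro ex1I[of _ "vec ls"]) metis+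
qed

end
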